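(* Let $R\in\mathbb N^p$ and $C\in\mathbb N^q$. If $\mathcal M(R,C)$ contains a matrix $\mathbf B$ which is a split zebra or a split anti-zebra, then $\mathbf B$ is the only element of $\mathcal M(R,C)$ having no negative checkerboard; i.e. $\mathbf B$ is the unique sink of $G(R,C)$.
   Context: $\mathcal M(R,C)$ denotes the set of $p\times q$ $(0,1)$-matrices with row sums $R$ and column sums $C$. A checkerboard is a $2\times2$ submatrix on rows $i<j$ and columns $k<l$; it is positive if equal to $\begin{pmatrix}1&0\\0&1\end{pmatrix}$ and negative if equal to $\begin{pmatrix}0&1\\1&0\end{pmatrix}$. A positive switch replaces a negative checkerboard by the positive one. $G(R,C)$ is the directed graph on $\mathcal M(R,C)$ with an arc $\mathbf A\to\mathbf A'$ when $\mathbf A'$ is obtained from $\mathbf A$ by one positive switch; a sink is a vertex with no outgoing arc. A $(0,1)$-matrix is nested (resp. anti-nested) if in every row and column all $1$s precede all $0$s (resp. all $0$s precede all $1$s). A zebra is a matrix of $\mathcal M(R,C)$ which equals $\mathbf N+\mathbf N'$ with $\mathbf N$ a nested $(0,1)$-matrix and $\mathbf N'$ an anti-nested $(0,1)$-matrix. A zebra is split vertically (resp. horizontally) if it admits such a decomposition in which no column (resp. no row) contains $1$s of both $\mathbf N$ and $\mathbf N'$; a split zebra is a zebra that is split vertically or horizontally. An anti-zebra (resp. split anti-zebra) is a matrix $\mathbf B$ with $b_{ij}=1-a_{p+1-i,j}$ for some zebra (resp. split zebra) $\mathbf A$, i.e. the complement of the matrix obtained from a zebra by reversing the order of its rows. 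*)

theory Defs
  imports "Jordan_Normal_Form.Matrix" "Graph_Theory.Digraph"
begin

text \<open>
  Rows and columns are indexed from 0, so that a \<open>p \<times> q\<close> matrix has row indices \<open>i < p\<close>
  and column indices \<open>j < q\<close>.  Margins and matrix entries are natural numbers.
\<close>

definition zero_one_mat :: "nat mat \<Rightarrow> bool" where
  "zero_one_mat A \<longleftrightarrow> (\<forall>i < dim_row A. \<forall>j < dim_col A. A $$ (i, j) \<in> {0, 1})"

definition margin_class :: "nat vec \<Rightarrow> nat vec \<Rightarrow> nat mat set" where
  "margin_class R C =
    {A \<in> carrier_mat (dim_vec R) (dim_vec C). zero_one_mat A \<and>
       (\<forall>i < dim_vec R. (\<Sum>j < dim_vec C. A $$ (i, j)) = R $ i) \<and>
       (\<forall>j < dim_vec C. (\<Sum>i < dim_vec R. A $$ (i, j)) = C $ j)}"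

definition positive_checkerboard :: "nat mat \<Rightarrow> nat \<Rightarrow> nat \<Rightarrow> nat \<Rightarrow> nat \<Rightarrow> bool" where
  "positive_checkerboard A i j k l \<longleftrightarrow>
    i < j \<and> j < dim_row A \<and> k < l \<and> l < dim_col A \<and>
    A $$ (i, k) = 1 \<and> A $$ (i, l) = 0 \<and>
    A $$ (j, k) = 0 \<and> A $$ (j, l) = 1"

definition negative_checkerboard :: "nat mat \<Rightarrow> nat \<Rightarrow> nat \<Rightarrow> nat \<Rightarrow> nat \<Rightarrow> bool" where
  "negative_checkerboard A i j k l \<longleftrightarrow>
    i < j \<and> j < dim_row A \<and> k < l \<and> l < dim_col A \<and>
    A $$ (i, k) = 0 \<and> A $$ (i, l) = 1 \<and>
    A $$ (j, k) = 1 \<and> A $$ (j, l) = 0"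

definition positive_switch :: "nat mat \<Rightarrow> nat mat \<Rightarrow> bool" where
  "positive_switch A A' \<longleftrightarrow>
    A' \<in> carrier_mat (dim_row A) (dim_col A) \<and>
    (\<exists>i j k l. negative_checkerboard A i j k l \<and> positive_checkerboard A' i j k l \<and>
       (\<forall>r < dim_row A. \<forall>s < dim_col A. (r, s) \<notin> {i, j} \<times> {k, l} \<longrightarrow> A' $$ (r, s) = A $$ (r, s)))"

definition switch_graph :: "nat vec \<Rightarrow> nat vec \<Rightarrow> (nat mat, nat mat \<times> nat mat) pre_digraph" where
  "switch_graph R C =
    \<lparr> verts = margin_class R C,
      arcs = {(A, A'). A \<in> margin_class R C \<and> A' \<in> margin_class R C \<and> positive_switch A A'},
      tail = fst, head = snd \<rparr>"

definition sink :: "('a, 'b) pre_digraph \<Rightarrow> 'a \<Rightarrow> bool" where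
  "sink G v \<longleftrightarrow> v \<in> verts G \<and> out_arcs G v = {}"

definition nested :: "nat mat \<Rightarrow> bool" where
  "nested A \<longleftrightarrow> zero_one_mat A \<and>
    (\<forall>i < dim_row A. \<forall>k < dim_col A. \<forall>l < dim_col A.
       A $$ (i, k) = 1 \<and> A $$ (i, l) = 0 \<longrightarrow> k < l) \<and>
    (\<forall>k < dim_col A. \<forall>i < dim_row A. \<forall>j < dim_row A.
       A $$ (i, k) = 1 \<and> A $$ (j, k) = 0 \<longrightarrow> i < j)"

definition anti_nested :: "nat mat \<Rightarrow> bool" where
  "anti_nested A \<longleftrightarrow> zero_one_mat A \<and>
    (\<forall>i < dim_row A. \<forall>k < dim_col A. \<forall>l < dim_col A.
       A $$ (i, k) = 0 \<and> A $$ (i, l) = 1 \<longrightarrow> k < l) \<and>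
    (\<forall>k < dim_col A. \<forall>i < dim_row A. \<forall>j < dim_row A.
       A $$ (i, k) = 0 \<and> A $$ (j, k) = 1 \<longrightarrow> i < j)"

text \<open>
  A zebra is a \<open>(0,1)\<close>-matrix, hence the ones of \<open>N\<close> and \<open>N'\<close> are in disjoint positions.
  No margins occur below, because every \<open>(0,1)\<close>-matrix lies in the class given by its own
  row and column sums.
\<close>

definition zebra_decomposition :: "nat mat \<Rightarrow> nat mat \<Rightarrow> nat mat \<Rightarrow> bool" where
  "zebra_decomposition A N N' \<longleftrightarrow>
    zero_one_mat A \<and>
    N \<in> carrier_mat (dim_row A) (dim_col A) \<and> N' \<in> carrier_mat (dim_row A) (dim_col A) \<and>
    nested N \<and> anti_nested N' \<and> A = N + N'"

definition zebra :: "nat mat \<Rightarrow> bool" where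
  "zebra A \<longleftrightarrow> (\<exists>N N'. zebra_decomposition A N N')"

definition vertically_split_zebra :: "nat mat \<Rightarrow> bool" where
  "vertically_split_zebra A \<longleftrightarrow>
    (\<exists>N N'. zebra_decomposition A N N' \<and>
       \<not> (\<exists>k < dim_col A. (\<exists>i < dim_row A. N $$ (i, k) = 1) \<and> (\<exists>i < dim_row A. N' $$ (i, k) = 1)))"

definition horizontally_split_zebra :: "nat mat \<Rightarrow> bool" where
  "horizontally_split_zebra A \<longleftrightarrow>
    (\<exists>N N'. zebra_decomposition A N N' \<and>
       \<not> (\<exists>i < dim_row A. (\<exists>k < dim_col A. N $$ (i, k) = 1) \<and> (\<exists>k < dim_col A. N' $$ (i, k) = 1)))"

definition split_zebra :: "nat mat \<Rightarrow> bool" where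
  "split_zebra A \<longleftrightarrow> vertically_split_zebra A \<or> horizontally_split_zebra A"

text \<open>
  With 0-based indices, reversing the order of \<open>p\<close> rows maps row \<open>i\<close> to row \<open>p - 1 - i\<close>.
\<close>

definition complement_row_reversal :: "nat mat \<Rightarrow> nat mat" where
  "complement_row_reversal A =
    mat (dim_row A) (dim_col A) (\<lambda>(i, j). 1 - A $$ (dim_row A - 1 - i, j))"

definition anti_zebra :: "nat mat \<Rightarrow> bool" where
  "anti_zebra B \<longleftrightarrow> (\<exists>A. zebra A \<and> B = complement_row_reversal A)"

definition split_anti_zebra :: "nat mat \<Rightarrow> bool" where
  "split_anti_zebra B \<longleftrightarrow> (\<exists>A. split_zebra A \<and> B = complement_row_reversal A)"

end

(*
  Transposition and complementation with row reversal both preserve margins and negative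
  checkerboards, so it suffices to treat a vertically split zebra B: a set L of columns, all to the
  left of the others, has its 1s on top, and the remaining columns have their 1s at the bottom.
  Let A have the margins of B and no negative checkerboard.  Among the pairs of rows i < j, those
  for which row i has a 1 above a 0 of row j in a column outside L form the inversion set of a
  permutation of the rows.  If A and B differ, take the first row m, in the permuted order, in
  which they differ.  It contains an entry where A is 1 and B is 0, whose column contains an entry
  where A is 0 and B is 1; the row of that entry precedes m in the permuted order.
*)
theory Submission
  imports Defs
begin

section \<open>Margins, checkerboards and the column split\<close>

text \<open>Comparing two matrices directly, without the vectors \<open>R\<close> and
  \<open>C\<close>, lets the relation pass through transposition and through complementation with
  row reversal.\<close>

definition equal_margins :: "nat mat \<Rightarrow> nat mat \<Rightarrow> bool" where
  "equal_margins A B \<longleftrightarrow>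
    dim_row A = dim_row B \<and> dim_col A = dim_col B \<and> zero_one_mat A \<and> zero_one_mat B \<and>
    (\<forall>i < dim_row B. (\<Sum>j < dim_col B. A $$ (i, j)) = (\<Sum>j < dim_col B. B $$ (i, j))) \<and>
    (\<forall>j < dim_col B. (\<Sum>i < dim_row B. A $$ (i, j)) = (\<Sum>i < dim_row B. B $$ (i, j)))"

definition checkerboard_free :: "nat mat \<Rightarrow> bool" where
  "checkerboard_free A \<longleftrightarrow> \<not> (\<exists>i j k l. negative_checkerboard A i j k l)"

text \<open>The last two clauses say that columns in \<open>L\<close> are weakly decreasing
  downwards and all other columns weakly increasing; a constant column may lie on either side,
  subject to the first clause.\<close>

definition column_split :: "nat mat \<Rightarrow> nat set \<Rightarrow> bool" where
  "column_split B L \<longleftrightarrow>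
    (\<forall>k < dim_col B. \<forall>l < dim_col B. k \<in> L \<and> l \<notin> L \<longrightarrow> k < l) \<and>
    (\<forall>k < dim_col B. \<forall>j < dim_row B. \<forall>i < j. B $$ (i, k) = 0 \<and> B $$ (j, k) = 1 \<longrightarrow> k \<notin> L) \<and>
    (\<forall>k < dim_col B. \<forall>j < dim_row B. \<forall>i < j. B $$ (i, k) = 1 \<and> B $$ (j, k) = 0 \<longrightarrow> k \<in> L)"

definition descent_outside :: "nat mat \<Rightarrow> nat set \<Rightarrow> nat \<Rightarrow> nat \<Rightarrow> bool" where
  "descent_outside A L i j \<longleftrightarrow> (\<exists>l < dim_col A. l \<notin> L \<and> A $$ (i, l) = 1 \<and> A $$ (j, l) = 0)"

definition row_less :: "nat mat \<Rightarrow> nat set \<Rightarrow> nat \<Rightarrow> nat \<Rightarrow> bool" where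
  "row_less A L i j \<longleftrightarrow>
    i < j \<and> \<not> descent_outside A L i j \<or> j < i \<and> descent_outside A L j i"

section \<open>The permuted order of the rows\<close>

lemma zero_one_matD:
  assumes "zero_one_mat A" "i < dim_row A" "j < dim_col A"
  shows "A $$ (i, j) = 0 \<or> A $$ (i, j) = 1"
  using assms by (auto simp: zero_one_mat_def)

lemma checkerboard_freeD:
  assumes "checkerboard_free A" "i < j" "j < dim_row A" "k < l" "l < dim_col A"
    and "A $$ (i, k) = 0" "A $$ (i, l) = 1" "A $$ (j, k) = 1" "A $$ (j, l) = 0"
  shows False
  using assms unfolding checkerboard_free_def negative_checkerboard_def by blast

text \<open>If no descent leads from \<open>i\<close> to \<open>m\<close>, then in the two
  witnessing columns \<open>x\<close>, \<open>y\<close> rows \<open>i\<close> and \<open>m\<close>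
  both read 1, 0 while row \<open>j\<close> reads 0, 1. Row \<open>j\<close> then forms a negative
  checkerboard with one of them: with \<open>i\<close> if \<open>y < x\<close>, with
  \<open>m\<close> if \<open>x < y\<close>.\<close>

lemma descent_outside_trans:
  assumes A: "zero_one_mat A" and free: "checkerboard_free A"
    and ij: "i < j" and jm: "j < m" and m: "m < dim_row A"
    and "descent_outside A L i j" "descent_outside A L j m"
  shows "descent_outside A L i m"
proof (rule ccontr)
  assume no: "\<not> ?thesis"
  obtain x y where x: "x < dim_col A" "x \<notin> L" "A $$ (i, x) = 1" "A $$ (j, x) = 0"
    and y: "y < dim_col A" "y \<notin> L" "A $$ (j, y) = 1" "A $$ (m, y) = 0"
    using assms(6,7) by (auto simp: descent_outside_def)
  have mx: "A $$ (m, x) = 1"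
    using no x zero_one_matD[OF A m x(1)] by (auto simp: descent_outside_def)
  have iy: "A $$ (i, y) = 0"
    using no y zero_one_matD[OF A _ y(1), of i] ij jm m by (auto simp: descent_outside_def)
  have "x \<noteq> y" using x y by auto
  then consider "y < x" | "x < y" by linarith
  then show False
  proof cases
    case 1
    then show False using checkerboard_freeD[OF free ij _ 1 x(1)] x y iy jm m by auto
  next
    case 2
    then show False using checkerboard_freeD[OF free jm m 2 y(1)] x y mx by auto
  qed
qed

text \<open>The column witnessing the descent from \<open>i\<close> to \<open>m\<close> serves one
  of the two pairs, depending on its entry in row \<open>j\<close>. Together with transitivity this
  is what characterises inversion sets of permutations.\<close>

lemma descent_outside_cotrans:
  assumes "zero_one_mat A" "j < dim_row A" "descent_outside A L i m"
  shows "descent_outside A L i j \<or> descent_outside A L j m"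
proof -
  obtain l where "l < dim_col A" "l \<notin> L" "A $$ (i, l) = 1" "A $$ (m, l) = 0"
    using assms(3) by (auto simp: descent_outside_def)
  then show ?thesis
    using zero_one_matD[OF assms(1,2), of l] by (auto simp: descent_outside_def)
qed

text \<open>Each of the six relative positions of \<open>a\<close>, \<open>b\<close>,
  \<open>c\<close> reduces to one property of descents: transitivity in cases 2, 3 and 6,
  cotransitivity in cases 1, 4 and 5.\<close>

lemma row_less_trans:
  assumes A: "zero_one_mat A" and free: "checkerboard_free A"
    and bounds: "a < dim_row A" "b < dim_row A" "c < dim_row A"
    and "row_less A L a b" "row_less A L b c"
  shows "row_less A L a c"
proof -
  note tr = descent_outside_trans[OF A free, where L = L]
  note co = descent_outside_cotrans[OF A, where L = L]
  have "a \<noteq> c" using assms(6,7) by (auto simp: row_less_def)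
  then consider "a < b" "b < c" | "a < c" "c < b" | "b < a" "a < c"
    | "b < c" "c < a" | "c < a" "a < b" | "c < b" "b < a"
    using assms(6,7) unfolding row_less_def by linarith
  then show ?thesis
  proof cases
    case 1
    then show ?thesis using assms(6,7) bounds co[of b a c] by (auto simp: row_less_def)
  next
    case 2
    then show ?thesis using assms(6,7) bounds tr[of a c b] by (auto simp: row_less_def)
  next
    case 3
    then show ?thesis using assms(6,7) bounds tr[of b a c] by (auto simp: row_less_def)
  next
    case 4
    then show ?thesis using assms(6,7) bounds co[of c b a] by (auto simp: row_less_def)
  next
    case 5
    then show ?thesis using assms(6,7) bounds co[of a c b] by (auto simp: row_less_def)
  next
    case 6
    then show ?thesis using assms(6,7) bounds tr[of c b a] by (auto simp: row_less_def)
  qed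
qed

section \<open>Uniqueness for matrices with a column split\<close>

lemma sum_eq_exchange:
  fixes f g :: "nat \<Rightarrow> nat"
  assumes "(\<Sum>x < n. f x) = (\<Sum>x < n. g x)" "y < n" "f y < g y"
  obtains x where "x < n" "g x < f x"
proof (rule ccontr)
  assume "\<not> thesis"
  then have "\<forall>x \<in> {..<n}. f x \<le> g x" using that not_less by blast
  then have "(\<Sum>x < n. f x) < (\<Sum>x < n. g x)"
    using assms(2,3) by (intro sum_strict_mono_ex1) auto
  then show False using assms(1) by simp
qed

text \<open>The row order is read off \<open>A\<close>, the set \<open>L\<close> comes from
  \<open>B\<close>. A gain of \<open>A\<close> over \<open>B\<close> in the least differing row is
  offset in its column by a loss, and the row of that loss also differs but is smaller.\<close>

lemma equal_margins_column_split_unique: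
  assumes margins: "equal_margins A B" and free: "checkerboard_free A" and split: "column_split B L"
  shows "A = B"
proof (rule ccontr)
  assume "A \<noteq> B"
  have dims: "dim_row A = dim_row B" "dim_col A = dim_col B"
    and A: "zero_one_mat A" and B: "zero_one_mat B"
    using margins by (auto simp: equal_margins_def)
  define D where "D = {i. i < dim_row B \<and> (\<exists>k < dim_col B. A $$ (i, k) \<noteq> B $$ (i, k))}"
  have "finite D" by (simp add: D_def)
  moreover have "D \<noteq> {}"
    using \<open>A \<noteq> B\<close> dims by (auto simp: D_def intro: eq_matI)
  moreover have "asymp_on D (row_less A L)"
    by (auto simp: asymp_on_def row_less_def)
  moreover have "transp_on D (row_less A L)"
    by (rule transp_onI) (use row_less_trans[OF A free] dims in \<open>auto simp: D_def\<close>)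
  ultimately obtain m where m: "m \<in> D" and least: "\<And>i. i \<in> D \<Longrightarrow> \<not> row_less A L i m"
    using Finite_Set.bex_min_element[of D "row_less A L"] by (metis row_less_def less_irrefl)
  have mB: "m < dim_row B" using m by (simp add: D_def)
  \<comment> \<open>The rows \<open>m\<close> of both matrices have equal sums, so if the differing
    entry is a loss for \<open>A\<close>, another entry of the row is a gain.\<close>
  obtain k where k: "k < dim_col B" and k_gain: "B $$ (m, k) < A $$ (m, k)"
  proof -
    obtain k0 where k0: "k0 < dim_col B" "A $$ (m, k0) \<noteq> B $$ (m, k0)"
      using m by (auto simp: D_def)
    show thesis
    proof (cases "A $$ (m, k0) < B $$ (m, k0)")
      case True
      show thesis
        by (rule sum_eq_exchange[of "\<lambda>j. A $$ (m, j)" "dim_col B" "\<lambda>j. B $$ (m, j)" k0])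
          (use margins mB k0 True that in \<open>auto simp: equal_margins_def\<close>)
    next
      case False
      then show thesis using that k0 by auto
    qed
  qed
  \<comment> \<open>The equal sums of column \<open>k\<close> force a loss that offsets the gain in
    row \<open>m\<close>.\<close>
  obtain i where i: "i < dim_row B" and i_loss: "A $$ (i, k) < B $$ (i, k)"
    by (rule sum_eq_exchange[of "\<lambda>i. B $$ (i, k)" "dim_row B" "\<lambda>i. A $$ (i, k)" m])
      (use margins mB k k_gain in \<open>auto simp: equal_margins_def\<close>)
  have mk: "A $$ (m, k) = 1" "B $$ (m, k) = 0"
    using k_gain zero_one_matD[OF A, of m k] zero_one_matD[OF B, of m k] mB k dims by auto
  have ik: "A $$ (i, k) = 0" "B $$ (i, k) = 1"
    using i_loss zero_one_matD[OF A, of i k] zero_one_matD[OF B, of i k] i k dims by auto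
  have "i \<in> D" using i k ik by (auto simp: D_def)
  moreover have "row_less A L i m"
  proof (cases "i < m")
    case True
    have "k \<in> L" using split True mB k ik mk unfolding column_split_def by blast
    have "\<not> descent_outside A L i m"
    proof
      assume "descent_outside A L i m"
      then obtain l where l: "l < dim_col A" "l \<notin> L" "A $$ (i, l) = 1" "A $$ (m, l) = 0"
        by (auto simp: descent_outside_def)
      \<comment> \<open>Since \<open>l\<close> lies to the right of \<open>k\<close>, rows
        \<open>i < m\<close> and columns \<open>k < l\<close> of \<open>A\<close> carry a negative
        checkerboard.\<close>
      then have "k < l" using split \<open>k \<in> L\<close> k dims unfolding column_split_def by metis
      then show False
        using checkerboard_freeD[OF free True _ \<open>k < l\<close>] l ik mk mB dims by auto
    qed
    then show ?thesis using True by (simp add: row_less_def)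
  next
    case False
    then have "m < i" using ik mk by (metis linorder_neqE_nat zero_neq_one)
    then have "k \<notin> L" using split i k ik mk unfolding column_split_def by blast
    \<comment> \<open>Column \<open>k\<close> itself witnesses the descent from \<open>m\<close>
      down to \<open>i\<close>, which reverses the two rows in the permuted order.\<close>
    then show ?thesis
      using \<open>m < i\<close> k ik mk dims by (auto simp: row_less_def descent_outside_def)
  qed
  ultimately show False using least by blast
qed

text \<open>The left column of a negative checkerboard has a 0 above a 1 and so lies outside
  \<open>L\<close>; the right one has a 1 above a 0 and so lies in \<open>L\<close>. This
  contradicts the order of the columns.\<close>

lemma column_split_checkerboard_free:
  assumes "column_split B L"
  shows "checkerboard_free B"
  unfolding checkerboard_free_def
proof (intro notI, elim exE)
  fix i j k l
  assume "negative_checkerboard B i j k l"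
  then have neg: "i < j" "j < dim_row B" "k < l" "l < dim_col B" "k < dim_col B"
      "B $$ (i, k) = 0" "B $$ (i, l) = 1" "B $$ (j, k) = 1" "B $$ (j, l) = 0"
    by (auto simp: negative_checkerboard_def)
  have "k \<notin> L" using assms neg unfolding column_split_def by blast
  moreover have "l \<in> L" using assms neg unfolding column_split_def by blast
  ultimately have "l < k" using assms neg unfolding column_split_def by blast
  then show False using neg by simp
qed

section \<open>From vertically split zebras to column splits\<close>

lemma vertically_split_zebra_column_split:
  assumes "vertically_split_zebra B"
  obtains L where "column_split B L"
proof -
  obtain N N' where dec: "zebra_decomposition B N N'"
    and split: "\<And>k i j. k < dim_col B \<Longrightarrow> i < dim_row B \<Longrightarrow> N $$ (i, k) = 1 \<Longrightarrow>
      j < dim_row B \<Longrightarrow> N' $$ (j, k) = 1 \<Longrightarrow> False"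
    using assms unfolding vertically_split_zebra_def by blast
  have carrier: "N \<in> carrier_mat (dim_row B) (dim_col B)" "N' \<in> carrier_mat (dim_row B) (dim_col B)"
    and nest: "nested N" "anti_nested N'" and sum: "B = N + N'"
    using dec unfolding zebra_decomposition_def by blast+
  have dims: "dim_row N = dim_row B" "dim_col N = dim_col B"
      "dim_row N' = dim_row B" "dim_col N' = dim_col B"
    using carrier by (blast dest: carrier_matD)+
  have 01: "zero_one_mat N" "zero_one_mat N'"
    using nest unfolding nested_def anti_nested_def by blast+
  have entry: "B $$ (i, k) = N $$ (i, k) + N' $$ (i, k)" if "i < dim_row B" "k < dim_col B" for i k
  proof -
    have "(N + N') $$ (i, k) = N $$ (i, k) + N' $$ (i, k)" using that dims by simp
    then show ?thesis by (simp only: sum[symmetric])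
  qed
  \<comment> \<open>On these columns \<open>N'\<close> vanishes because the zebra is split, and on
    all others \<open>N\<close> vanishes, so each column of \<open>B\<close> is a column of
    \<open>N\<close> or of \<open>N'\<close>.\<close>
  define L where "L = {k. \<exists>i < dim_row B. N $$ (i, k) = 1}"
  have left: "B $$ (i, k) = N $$ (i, k)" if "k \<in> L" "i < dim_row B" "k < dim_col B" for i k
    using that entry[of i k] zero_one_matD[OF 01(2), of i k] split[of k _ i] dims
    by (auto simp: L_def)
  have right: "N $$ (i, k) = 0" "B $$ (i, k) = N' $$ (i, k)"
    if "k \<notin> L" "i < dim_row B" "k < dim_col B" for i k
    using that entry[of i k] zero_one_matD[OF 01(1), of i k] dims by (auto simp: L_def)
  have "column_split B L"
    unfolding column_split_def
  proof (intro conjI allI impI; elim conjE)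
    fix k l
    assume kl: "k < dim_col B" "l < dim_col B" "k \<in> L" "l \<notin> L"
    then obtain i where i: "i < dim_row B" "N $$ (i, k) = 1" by (auto simp: L_def)
    \<comment> \<open>Row \<open>i\<close> of \<open>N\<close> has a 1 in column \<open>k\<close>
      and a 0 in column \<open>l\<close>; nestedness along this row gives the order of the
      columns.\<close>
    have "N $$ (i, l) = 0" using right(1) kl i by blast
    then show "k < l" using nest(1) i kl dims unfolding nested_def by metis
  next
    fix k j i
    assume *: "k < dim_col B" "j < dim_row B" "i < j" "B $$ (i, k) = 0" "B $$ (j, k) = 1"
    show "k \<notin> L"
    proof
      assume "k \<in> L"
      then have "N $$ (i, k) = 0" "N $$ (j, k) = 1" using left[of k] * by auto
      moreover have "i < dim_row B" using * by simp
      ultimately have "j < i" using nest(1) * dims unfolding nested_def by metis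
      then show False using * by simp
    qed
  next
    fix k j i
    assume *: "k < dim_col B" "j < dim_row B" "i < j" "B $$ (i, k) = 1" "B $$ (j, k) = 0"
    show "k \<in> L"
    proof (rule ccontr)
      assume "k \<notin> L"
      then have "N' $$ (i, k) = 1" "N' $$ (j, k) = 0" using right(2)[of k] * by auto
      moreover have "i < dim_row B" using * by simp
      ultimately have "j < i" using nest(2) * dims unfolding anti_nested_def by metis
      then show False using * by simp
    qed
  qed
  then show thesis by (rule that)
qed

section \<open>Transposition\<close>

lemma zero_one_mat_transpose: "zero_one_mat A \<Longrightarrow> zero_one_mat A\<^sup>T"
  by (auto simp: zero_one_mat_def)

lemma equal_margins_transpose: "equal_margins A B \<Longrightarrow> equal_margins A\<^sup>T B\<^sup>T"
  by (auto simp: equal_margins_def zero_one_mat_transpose)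

text \<open>The negative checkerboard is a symmetric matrix, so transposing only exchanges its row
  and column indices.\<close>

lemma checkerboard_free_transpose:
  assumes "checkerboard_free A"
  shows "checkerboard_free A\<^sup>T"
  unfolding checkerboard_free_def
proof (intro notI, elim exE)
  fix i j k l
  assume "negative_checkerboard A\<^sup>T i j k l"
  then have "negative_checkerboard A k l i j"
    by (auto simp: negative_checkerboard_def)
  then show False using assms by (auto simp: checkerboard_free_def)
qed

lemma nested_transpose:
  assumes "nested N"
  shows "nested N\<^sup>T"
  unfolding nested_def
proof (intro conjI allI impI)
  show "zero_one_mat N\<^sup>T"
    using assms unfolding nested_def by (blast intro: zero_one_mat_transpose)
next
  fix i k l
  assume "i < dim_row N\<^sup>T" "k < dim_col N\<^sup>T" "l < dim_col N\<^sup>T"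
    "N\<^sup>T $$ (i, k) = 1 \<and> N\<^sup>T $$ (i, l) = 0"
  then have "i < dim_col N" "k < dim_row N" "l < dim_row N" "N $$ (k, i) = 1" "N $$ (l, i) = 0"
    by simp_all
  then show "k < l" using assms unfolding nested_def by blast
next
  fix k i j
  assume "k < dim_col N\<^sup>T" "i < dim_row N\<^sup>T" "j < dim_row N\<^sup>T"
    "N\<^sup>T $$ (i, k) = 1 \<and> N\<^sup>T $$ (j, k) = 0"
  then have "k < dim_row N" "i < dim_col N" "j < dim_col N" "N $$ (k, i) = 1" "N $$ (k, j) = 0"
    by simp_all
  then show "i < j" using assms unfolding nested_def by blast
qed

lemma anti_nested_transpose:
  assumes "anti_nested N"
  shows "anti_nested N\<^sup>T"
  unfolding anti_nested_def
proof (intro conjI allI impI)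
  show "zero_one_mat N\<^sup>T"
    using assms unfolding anti_nested_def by (blast intro: zero_one_mat_transpose)
next
  fix i k l
  assume "i < dim_row N\<^sup>T" "k < dim_col N\<^sup>T" "l < dim_col N\<^sup>T"
    "N\<^sup>T $$ (i, k) = 0 \<and> N\<^sup>T $$ (i, l) = 1"
  then have "i < dim_col N" "k < dim_row N" "l < dim_row N" "N $$ (k, i) = 0" "N $$ (l, i) = 1"
    by simp_all
  then show "k < l" using assms unfolding anti_nested_def by blast
next
  fix k i j
  assume "k < dim_col N\<^sup>T" "i < dim_row N\<^sup>T" "j < dim_row N\<^sup>T"
    "N\<^sup>T $$ (i, k) = 0 \<and> N\<^sup>T $$ (j, k) = 1"
  then have "k < dim_row N" "i < dim_col N" "j < dim_col N" "N $$ (k, i) = 0" "N $$ (k, j) = 1"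
    by simp_all
  then show "i < j" using assms unfolding anti_nested_def by blast
qed

lemma zebra_decomposition_transpose:
  assumes "zebra_decomposition A N N'"
  shows "zebra_decomposition A\<^sup>T N\<^sup>T N'\<^sup>T"
proof -
  have *: "zero_one_mat A" "N \<in> carrier_mat (dim_row A) (dim_col A)"
      "N' \<in> carrier_mat (dim_row A) (dim_col A)" "nested N" "anti_nested N'" "A = N + N'"
    using assms unfolding zebra_decomposition_def by blast+
  have "(N + N')\<^sup>T = N\<^sup>T + N'\<^sup>T" using *(2,3) by (rule transpose_add)
  then have "A\<^sup>T = N\<^sup>T + N'\<^sup>T" by (simp only: *(6)[symmetric])
  then show ?thesis
    using *(1-5) zero_one_mat_transpose nested_transpose anti_nested_transpose transpose_carrier_mat
    unfolding zebra_decomposition_def index_transpose_mat(2,3) by blast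
qed

lemma horizontally_split_zebra_transpose:
  assumes "horizontally_split_zebra A"
  shows "vertically_split_zebra A\<^sup>T"
proof -
  obtain N N' where dec: "zebra_decomposition A N N'"
    and "\<not> (\<exists>i < dim_row A. (\<exists>k < dim_col A. N $$ (i, k) = 1) \<and> (\<exists>k < dim_col A. N' $$ (i, k) = 1))"
    using assms by (auto simp: horizontally_split_zebra_def)
  moreover have "dim_row N = dim_row A" "dim_col N = dim_col A"
      "dim_row N' = dim_row A" "dim_col N' = dim_col A"
    using dec unfolding zebra_decomposition_def by (blast dest: carrier_matD)+
  ultimately have "\<not> (\<exists>k < dim_col A\<^sup>T. (\<exists>i < dim_row A\<^sup>T. N\<^sup>T $$ (i, k) = 1) \<and>
      (\<exists>i < dim_row A\<^sup>T. N'\<^sup>T $$ (i, k) = 1))"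
    by auto
  then show ?thesis
    using zebra_decomposition_transpose[OF dec] unfolding vertically_split_zebra_def by blast
qed

section \<open>Complementation with row reversal\<close>

lemma dim_complement_row_reversal [simp]:
  "dim_row (complement_row_reversal A) = dim_row A"
  "dim_col (complement_row_reversal A) = dim_col A"
  by (simp_all add: complement_row_reversal_def)

lemma index_complement_row_reversal:
  "i < dim_row A \<Longrightarrow> j < dim_col A \<Longrightarrow>
    complement_row_reversal A $$ (i, j) = 1 - A $$ (dim_row A - Suc i, j)"
  by (simp add: complement_row_reversal_def)

lemma zero_one_mat_complement_row_reversal: "zero_one_mat (complement_row_reversal A)"
  by (auto simp: zero_one_mat_def index_complement_row_reversal)

text \<open>Subtraction is truncated, so \<open>1 - (1 - x) = x\<close> relies on the entries being
  0 or 1.\<close>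

lemma complement_row_reversal_involution:
  assumes "zero_one_mat A"
  shows "complement_row_reversal (complement_row_reversal A) = A"
proof (rule eq_matI)
  fix i j assume ij: "i < dim_row A" "j < dim_col A"
  then show "complement_row_reversal (complement_row_reversal A) $$ (i, j) = A $$ (i, j)"
    using zero_one_matD[OF assms ij] by (auto simp: index_complement_row_reversal)
qed simp_all

text \<open>Reversing the rows turns a negative checkerboard into a positive one, and complementing
  turns it back.\<close>

lemma checkerboard_free_complement_row_reversal:
  assumes "checkerboard_free A" "zero_one_mat A"
  shows "checkerboard_free (complement_row_reversal A)"
  unfolding checkerboard_free_def
proof (intro notI, elim exE)
  fix i j k l
  assume neg: "negative_checkerboard (complement_row_reversal A) i j k l"
  let ?i = "dim_row A - Suc i" and ?j = "dim_row A - Suc j"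
  have bounds: "i < j" "j < dim_row A" "k < l" "l < dim_col A"
    using neg by (auto simp: negative_checkerboard_def)
  then have "complement_row_reversal A $$ (i, k) = 1 - A $$ (?i, k)"
      "complement_row_reversal A $$ (i, l) = 1 - A $$ (?i, l)"
      "complement_row_reversal A $$ (j, k) = 1 - A $$ (?j, k)"
      "complement_row_reversal A $$ (j, l) = 1 - A $$ (?j, l)"
    by (simp_all add: index_complement_row_reversal)
  then have "A $$ (?j, k) = 0" "A $$ (?j, l) = 1" "A $$ (?i, k) = 1" "A $$ (?i, l) = 0"
    using neg bounds zero_one_matD[OF assms(2), of ?i k] zero_one_matD[OF assms(2), of ?j k]
      zero_one_matD[OF assms(2), of ?i l] zero_one_matD[OF assms(2), of ?j l]
    by (auto simp: negative_checkerboard_def)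
  moreover have "?j < ?i" "?i < dim_row A" using bounds by linarith+
  ultimately show False
    using checkerboard_freeD[OF assms(1), of ?j ?i k l] bounds by blast
qed

lemma sum_one_minus:
  fixes f :: "nat \<Rightarrow> nat"
  assumes "\<And>x. x < n \<Longrightarrow> f x \<le> 1"
  shows "(\<Sum>x < n. 1 - f x) = n - (\<Sum>x < n. f x)"
  using sum_subtractf_nat[of "{..<n}" f "\<lambda>_. 1"] assms by auto

lemma row_sum_complement_row_reversal:
  assumes "zero_one_mat A" "i < dim_row A"
  shows "(\<Sum>j < dim_col A. complement_row_reversal A $$ (i, j)) =
    dim_col A - (\<Sum>j < dim_col A. A $$ (dim_row A - Suc i, j))"
proof -
  have "(\<Sum>j < dim_col A. 1 - A $$ (dim_row A - Suc i, j)) =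
      dim_col A - (\<Sum>j < dim_col A. A $$ (dim_row A - Suc i, j))"
  proof (rule sum_one_minus)
    fix j assume "j < dim_col A"
    then show "A $$ (dim_row A - Suc i, j) \<le> 1"
      using zero_one_matD[OF assms(1), of "dim_row A - Suc i" j] assms(2) by auto
  qed
  then show ?thesis using assms by (simp add: index_complement_row_reversal)
qed

lemma column_sum_complement_row_reversal:
  assumes "zero_one_mat A" "j < dim_col A"
  shows "(\<Sum>i < dim_row A. complement_row_reversal A $$ (i, j)) =
    dim_row A - (\<Sum>i < dim_row A. A $$ (i, j))"
proof -
  have "(\<Sum>i < dim_row A. complement_row_reversal A $$ (i, j)) =
      (\<Sum>i < dim_row A. 1 - A $$ (dim_row A - Suc i, j))"
    using assms by (simp add: index_complement_row_reversal)
  also have "\<dots> = (\<Sum>i < dim_row A. 1 - A $$ (i, j))"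
    by (rule sum.nat_diff_reindex)
  also have "\<dots> = dim_row A - (\<Sum>i < dim_row A. A $$ (i, j))"
    using assms by (intro sum_one_minus) (force simp: zero_one_mat_def)
  finally show ?thesis .
qed

text \<open>The margins of the image depend only on those of the original: every sum is subtracted
  from the length of its row or column, and the row sums are reversed.\<close>

lemma equal_margins_complement_row_reversal:
  assumes "equal_margins A B"
  shows "equal_margins (complement_row_reversal A) (complement_row_reversal B)"
  using assms row_sum_complement_row_reversal[of A] row_sum_complement_row_reversal[of B]
    column_sum_complement_row_reversal[of A] column_sum_complement_row_reversal[of B]
  by (auto simp: equal_margins_def zero_one_mat_complement_row_reversal)

section \<open>Split zebras and split anti-zebras\<close>

lemma split_zebra_cases:
  assumes "split_zebra B"
  obtains L where "column_split B L" | L where "column_split B\<^sup>T L"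
  using assms horizontally_split_zebra_transpose vertically_split_zebra_column_split
  unfolding split_zebra_def by blast

lemma split_zebra_checkerboard_free:
  assumes "split_zebra B"
  shows "checkerboard_free B"
  using assms
proof (cases rule: split_zebra_cases)
  case (1 L)
  then show ?thesis by (rule column_split_checkerboard_free)
next
  case (2 L)
  then show ?thesis
    \<comment> \<open>Transposing twice returns to \<open>B\<close>.\<close>
    using checkerboard_free_transpose[OF column_split_checkerboard_free] by fastforce
qed

lemma split_zebra_unique:
  assumes "split_zebra B" "equal_margins A B" "checkerboard_free A"
  shows "A = B"
  using assms(1)
proof (cases rule: split_zebra_cases)
  case (1 L)
  then show ?thesis using equal_margins_column_split_unique assms(2,3) by blast
next
  case (2 L)
  then have "A\<^sup>T = B\<^sup>T"
    using equal_margins_column_split_unique equal_margins_transpose[OF assms(2)]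
      checkerboard_free_transpose[OF assms(3)] by blast
  then show ?thesis by simp
qed

lemma split_zebra_zero_one_mat: "split_zebra B \<Longrightarrow> zero_one_mat B"
  by (auto simp: split_zebra_def vertically_split_zebra_def horizontally_split_zebra_def
      zebra_decomposition_def)

lemma split_anti_zebra_checkerboard_free:
  assumes "split_anti_zebra B"
  shows "checkerboard_free B"
  using assms split_zebra_checkerboard_free split_zebra_zero_one_mat
    checkerboard_free_complement_row_reversal
  unfolding split_anti_zebra_def by blast

text \<open>The involution carries \<open>B\<close> to a split zebra \<open>Z\<close> and
  \<open>A\<close> to a checkerboard-free matrix with the margins of \<open>Z\<close>, so uniqueness
  is inherited.\<close>

lemma split_anti_zebra_unique:
  assumes "split_anti_zebra B" "equal_margins A B" "checkerboard_free A"
  shows "A = B"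
proof -
  obtain Z where Z: "split_zebra Z" "B = complement_row_reversal Z"
    using assms(1) by (auto simp: split_anti_zebra_def)
  have A: "zero_one_mat A" using assms(2) by (simp add: equal_margins_def)
  have "equal_margins (complement_row_reversal A) Z"
    using equal_margins_complement_row_reversal[OF assms(2)] Z
    by (simp add: complement_row_reversal_involution split_zebra_zero_one_mat)
  then have "complement_row_reversal A = Z"
    using split_zebra_unique Z(1) checkerboard_free_complement_row_reversal[OF assms(3) A] by blast
  then show ?thesis using Z(2) complement_row_reversal_involution[OF A] by simp
qed

section \<open>Sinks of the switch graph\<close>

lemma margin_class_equal_margins:
  "A \<in> margin_class R C \<Longrightarrow> B \<in> margin_class R C \<Longrightarrow> equal_margins A B"
  by (auto simp: margin_class_def equal_margins_def)

text \<open>Serves to show that a switch preserves margins: within a row or column it alters at most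
  two entries and keeps their total.\<close>

lemma sum_exchange_two:
  fixes f g :: "nat \<Rightarrow> nat"
  assumes "k < n" "l < n" "k \<noteq> l" "f k + f l = g k + g l"
    and "\<And>x. x < n \<Longrightarrow> x \<noteq> k \<Longrightarrow> x \<noteq> l \<Longrightarrow> f x = g x"
  shows "(\<Sum>x < n. f x) = (\<Sum>x < n. g x)"
proof -
  have split: "(\<Sum>x < n. h x) = h k + (h l + (\<Sum>x \<in> {..<n} - {k} - {l}. h x))" for h :: "nat \<Rightarrow> nat"
    using assms(1-3) by (simp add: sum.remove[of "{..<n}" k] sum.remove[of "{..<n} - {k}" l])
  have "(\<Sum>x \<in> {..<n} - {k} - {l}. f x) = (\<Sum>x \<in> {..<n} - {k} - {l}. g x)"
    using assms(5) by (intro sum.cong) auto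
  then show ?thesis using assms(4) by (simp add: split)
qed

text \<open>Supplies the arc that leaves a vertex with a negative checkerboard; the point is that
  the switched matrix stays in the class.\<close>

lemma positive_switch_exists:
  assumes A: "A \<in> margin_class R C" and neg: "negative_checkerboard A i j k l"
  obtains A' where "A' \<in> margin_class R C" "positive_switch A A'"
proof -
  \<comment> \<open>Complementing the four corners of a negative checkerboard makes it
    positive.\<close>
  define A' where "A' = mat (dim_row A) (dim_col A)
    (\<lambda>(r, s). if r \<in> {i, j} \<and> s \<in> {k, l} then 1 - A $$ (r, s) else A $$ (r, s))"
  have dims: "dim_row A = dim_vec R" "dim_col A = dim_vec C" "dim_row A' = dim_vec R"
      "dim_col A' = dim_vec C"
    using A by (auto simp: margin_class_def A'_def)
  have bounds: "i < j" "i < dim_vec R" "j < dim_vec R" "k < l" "k < dim_vec C" "l < dim_vec C"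
    using neg dims by (auto simp: negative_checkerboard_def)
  have old: "A $$ (i, k) = 0" "A $$ (i, l) = 1" "A $$ (j, k) = 1" "A $$ (j, l) = 0"
    using neg by (auto simp: negative_checkerboard_def)
  have entry: "A' $$ (r, s) = (if r \<in> {i, j} \<and> s \<in> {k, l} then 1 - A $$ (r, s) else A $$ (r, s))"
    if "r < dim_vec R" "s < dim_vec C" for r s
    using that dims by (simp add: A'_def)
  have new: "A' $$ (i, k) = 1" "A' $$ (i, l) = 0" "A' $$ (j, k) = 0" "A' $$ (j, l) = 1"
    using bounds old by (simp_all add: entry)
  have rows: "(\<Sum>s < dim_vec C. A' $$ (r, s)) = (\<Sum>s < dim_vec C. A $$ (r, s))"
    if "r < dim_vec R" for r
    using that bounds old new
    by (intro sum_exchange_two[of k _ l]) (auto simp: entry)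
  have columns: "(\<Sum>r < dim_vec R. A' $$ (r, s)) = (\<Sum>r < dim_vec R. A $$ (r, s))"
    if "s < dim_vec C" for s
    using that bounds old new
    by (intro sum_exchange_two[of i _ j]) (auto simp: entry)
  have "zero_one_mat A'"
    using A dims by (auto simp: zero_one_mat_def entry margin_class_def)
  then have "A' \<in> margin_class R C"
    using A dims rows columns by (auto simp: margin_class_def)
  moreover have "positive_checkerboard A' i j k l"
    using bounds new dims by (simp add: positive_checkerboard_def)
  then have "positive_switch A A'"
    unfolding positive_switch_def
  proof (intro conjI exI)
    show "A' \<in> carrier_mat (dim_row A) (dim_col A)" by (simp add: A'_def)
    show "\<forall>r < dim_row A. \<forall>s < dim_col A.
        (r, s) \<notin> {i, j} \<times> {k, l} \<longrightarrow> A' $$ (r, s) = A $$ (r, s)"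
      using dims entry by auto
  qed (rule neg)
  ultimately show thesis by (rule that)
qed

lemma sink_switch_graph_iff:
  "sink (switch_graph R C) A \<longleftrightarrow> A \<in> margin_class R C \<and> checkerboard_free A"
proof
  assume sink: "sink (switch_graph R C) A"
  then have A: "A \<in> margin_class R C" by (simp add: sink_def switch_graph_def)
  have "checkerboard_free A"
    unfolding checkerboard_free_def
  proof (intro notI, elim exE)
    fix i j k l
    assume "negative_checkerboard A i j k l"
    then obtain A' where "A' \<in> margin_class R C" "positive_switch A A'"
      using positive_switch_exists[OF A] by blast
    then have "(A, A') \<in> out_arcs (switch_graph R C) A"
      using A by (simp add: out_arcs_def switch_graph_def)
    then show False using sink unfolding sink_def by blast
  qed
  then show "A \<in> margin_class R C \<and> checkerboard_free A" using A by simp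
next
  assume "A \<in> margin_class R C \<and> checkerboard_free A"
  then show "sink (switch_graph R C) A"
    by (auto simp: sink_def switch_graph_def out_arcs_def positive_switch_def checkerboard_free_def)
qed

theorem theorem2:
  fixes p q :: nat and R C :: "nat vec" and B :: "nat mat"
  assumes "R \<in> carrier_vec p" and "C \<in> carrier_vec q"
    and "B \<in> margin_class R C"
    and "split_zebra B \<or> split_anti_zebra B"
  shows "{A \<in> margin_class R C. \<not> (\<exists>i j k l. negative_checkerboard A i j k l)} = {B}
    \<and> {A. sink (switch_graph R C) A} = {B}"
proof -
  have "checkerboard_free B"
    using assms(4) split_zebra_checkerboard_free split_anti_zebra_checkerboard_free by blast
  moreover have "A = B" if "A \<in> margin_class R C" "checkerboard_free A" for A
    using assms(4) that split_zebra_unique split_anti_zebra_unique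
      margin_class_equal_margins[OF that(1) assms(3)] by blast
  ultimately have "{A \<in> margin_class R C. checkerboard_free A} = {B}"
    using assms(3) by blast
  then show ?thesis
    unfolding sink_switch_graph_iff checkerboard_free_def by simp
qed

end
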